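(* Suppose we have an $I\times2\times K$ contingency table with binary outcomes. Let $g:\mathbb{R}^K\to\mathbb{R}$ be a component-wise monotone-increasing function, i.e. $g(\mathbf{T})\le g(\mathbf{T}')$ whenever $T_k\le T_k'$ for all $k=1,\dots,K$. Let $\mathbf{T}=(T_1,\dots,T_K)$ be the vector of sign-score statistics across the $K$ strata, where $T_k=\sum_{i=1}^Iw_{ki}N_{ki2}$ and $w_{k1}\le w_{k2}\le\cdots\le w_{kI}$. Under the joint sharp null hypothesis and the sensitivity model with parameters $\gamma\ge0$ and $\boldsymbol\delta\in\{0,1\}^I$, the exact worst-case null distribution of $g(\mathbf{T})$ is, for all $c\in\mathbb{R}$, $$\max_{\mathbf{u}_1\in[0,1]^{N_1},\dots,\mathbf{u}_K\in[0,1]^{N_K}}\mathbb{P}_{\mathbf{u}_1,\dots,\mathbf{u}_K}\big(g(\mathbf{T})\ge c\big)=\mathbb{P}\big(g(\overline{\mathbf{T}})\ge c\big),$$ where the random vector $\overline{\mathbf{T}}=(\overline T_1,\dots,\overline T_K)$ consists of $\overline T_k=\sum_{i=1}^Iw_{ki}M_{ki}$, and $\mathbf{M}_k=(M_{k1},\dots,M_{kI})$, independent across $k=1,\dots,K$, follows a multivariate extended hypergeometric distribution with parameters $\mathbf{N}_{kI\cdot}=(N_{k1\cdot},\dots,N_{kI\cdot})$, $N_{k\cdot2}$ and $\gamma\boldsymbol\delta=(\gamma\delta_1,\dots,\gamma\delta_I)$, that is, $\mathbb{P}(\mathbf{M}_k=\mathbf{t})\propto\prod_{i=1}^I\binom{N_{ki\cdot}}{t_i}\exp(\gamma\delta_it_i)$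 for $\mathbf{t}\in\mathbb{Z}_{\ge0}^I$ with $\sum_it_i=N_{k\cdot2}$.
   Context: There are $K$ strata; stratum $k$ has $N_k$ subjects, fixed positive treatment counts $N_{k1\cdot},\dots,N_{kI\cdot}$ summing to $N_k$, and, under the joint sharp null hypothesis (no treatment effect for any subject in any stratum), a fixed outcome vector $(r_{k1},\dots,r_{kN_k})\in\{1,2\}^{N_k}$. Let $N_{k\cdot2}=|\{s:r_{ks}=2\}|$ and $\mathcal{Z}(\mathbf{N}_{kI\cdot})=\{\mathbf{z}\in\{1,\dots,I\}^{N_k}:|\{s:z_s=i\}|=N_{ki\cdot}\ \forall i\}$. The sensitivity parameters are $\gamma\ge0$ and $\boldsymbol\delta=(\delta_1,\dots,\delta_I)\in\{0,1\}^I$, whose entries are not all equal. Within each stratum all subjects share the same observed covariates. For unmeasured confounders $\mathbf{u}_k=(u_{k1},\dots,u_{kN_k})\in[0,1]^{N_k}$, under $\mathbb{P}_{\mathbf{u}_1,\dots,\mathbf{u}_K}$ the treatment vectors $\mathbf{Z}_1,\dots,\mathbf{Z}_K$ are independent across strata and (sensitivity model, conditional on the treatment counts) $$\mathbb{P}(\mathbf{Z}_k=\mathbf{z})=\frac{\exp\{\gamma\sum_{s=1}^{N_k}\delta_{z_s}u_{ks}\}}{\sum_{\mathbf{b}\in\mathcal{Z}(\mathbf{N}_{kI\cdot})}\exp\{\gamma\sum_{s=1}^{N_k}\delta_{b_s}u_{ks}\}},\qquad\mathbf{z}\in\mathcal{Z}(\mathbf{N}_{kI\cdot}).$$ The cell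 counts are $N_{ki2}=\sum_{s=1}^{N_k}\mathbb{1}\{Z_{ks}=i,r_{ks}=2\}$. Binomial coefficients $\binom{n}{m}$ with $m>n$ are $0$.
   Formalization: Adds the hypothesis that in each stratum treatments with δ=1 have scores at least as large as those with δ=0; without it the claim fails, e.g. K=1, I=2, one subject per treatment, r=(2,1), w=(0,1), δ=(1,0), γ=1, g=id, c=1. *)

theory Defs
  imports "HOL-Probability.Probability"
begin

text \<open>
  The probability distribution on a finite set \<open>S\<close> proportional to \<open>f\<close>. It is meaningful only for
  \<open>f \<ge> 0\<close> on \<open>S\<close> with positive total weight; see \<open>pmf_weighted_pmf\<close>.
\<close>

definition weighted_pmf :: "'a set \<Rightarrow> ('a \<Rightarrow> real) \<Rightarrow> 'a pmf" where
  "weighted_pmf S f = embed_pmf (\<lambda>x. if x \<in> S then f x / (\<Sum>y\<in>S. f y) else 0)"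

lemma pmf_weighted_pmf:
  assumes "finite S" and nonneg: "\<And>x. x \<in> S \<Longrightarrow> 0 \<le> f x" and pos: "0 < (\<Sum>y\<in>S. f y)"
  shows "pmf (weighted_pmf S f) x = (if x \<in> S then f x / (\<Sum>y\<in>S. f y) else 0)"
proof -
  let ?h = "\<lambda>x. if x \<in> S then f x / (\<Sum>y\<in>S. f y) else 0"
  have nn: "0 \<le> ?h x" for x
    using nonneg pos by simp
  have "(\<integral>\<^sup>+x. ennreal (?h x) \<partial>count_space UNIV) = (\<Sum>x\<in>S. ennreal (?h x))"
    using \<open>finite S\<close> by (intro nn_integral_count_space') auto
  also have "\<dots> = ennreal (\<Sum>x\<in>S. ?h x)"
    by (rule sum_ennreal) (rule nn)
  also have "(\<Sum>x\<in>S. ?h x) = 1"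
    using pos by (simp flip: sum_divide_distrib)
  finally show ?thesis
    unfolding weighted_pmf_def using nn by (subst pmf_embed_pmf) auto
qed

text \<open>
  Treatments are \<open>1, \<dots>, I\<close>, the subjects of a stratum are \<open>1, \<dots>, n\<close>, and \<open>cnt i\<close> is the
  number of subjects that receive treatment \<open>i\<close>.
\<close>

definition assignments :: "nat \<Rightarrow> nat \<Rightarrow> (nat \<Rightarrow> nat) \<Rightarrow> (nat \<Rightarrow> nat) set" where
  "assignments I n cnt =
     {z \<in> {1..n} \<rightarrow>\<^sub>E {1..I}. \<forall>i\<in>{1..I}. card {s\<in>{1..n}. z s = i} = cnt i}"

definition treatment_pmf ::
    "nat \<Rightarrow> nat \<Rightarrow> (nat \<Rightarrow> nat) \<Rightarrow> real \<Rightarrow> (nat \<Rightarrow> real) \<Rightarrow> (nat \<Rightarrow> real) \<Rightarrow> (nat \<Rightarrow> nat) pmf" where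
  "treatment_pmf I n cnt \<gamma> \<delta> u =
     weighted_pmf (assignments I n cnt) (\<lambda>z. exp (\<gamma> * (\<Sum>s=1..n. \<delta> (z s) * u s)))"

definition outcome_count :: "nat \<Rightarrow> (nat \<Rightarrow> nat) \<Rightarrow> nat" where
  "outcome_count n r = card {s\<in>{1..n}. r s = 2}"

definition cell_count :: "nat \<Rightarrow> (nat \<Rightarrow> nat) \<Rightarrow> (nat \<Rightarrow> nat) \<Rightarrow> nat \<Rightarrow> nat" where
  "cell_count n r z i = card {s\<in>{1..n}. z s = i \<and> r s = 2}"

definition sign_score :: "nat \<Rightarrow> (nat \<Rightarrow> real) \<Rightarrow> (nat \<Rightarrow> nat) \<Rightarrow> real" where
  "sign_score I w t = (\<Sum>i=1..I. w i * real (t i))"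

text \<open>
  The multivariate extended hypergeometric distribution for group sizes \<open>cnt\<close>, \<open>m\<close> draws and
  log-weights \<open>\<psi>\<close>. Vectors \<open>t\<close> with some \<open>t i > cnt i\<close> have weight 0 because the binomial
  coefficient vanishes.
\<close>

definition ext_hypergeometric_pmf ::
    "nat \<Rightarrow> (nat \<Rightarrow> nat) \<Rightarrow> nat \<Rightarrow> (nat \<Rightarrow> real) \<Rightarrow> (nat \<Rightarrow> nat) pmf" where
  "ext_hypergeometric_pmf I cnt m \<psi> =
     weighted_pmf {t \<in> {1..I} \<rightarrow>\<^sub>E UNIV. (\<Sum>i=1..I. t i) = m}
       (\<lambda>t. \<Prod>i=1..I. real (cnt i choose t i) * exp (\<psi> i * real (t i)))"

text \<open>
  The laws of the vectors \<open>(T\<^sub>k)\<^sub>k\<close> and \<open>(T\<^sub>k bar)\<^sub>k\<close>: the strata are the elements of the finite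
  type \<open>'k\<close>, and \<^const>\<open>Pi_pmf\<close> makes them independent (over \<^const>\<open>UNIV\<close> its default value is
  never used).
\<close>

definition score_pmf ::
    "nat \<Rightarrow> ('k::finite \<Rightarrow> nat) \<Rightarrow> ('k \<Rightarrow> nat \<Rightarrow> nat) \<Rightarrow> ('k \<Rightarrow> nat \<Rightarrow> nat) \<Rightarrow> ('k \<Rightarrow> nat \<Rightarrow> real)
       \<Rightarrow> real \<Rightarrow> (nat \<Rightarrow> real) \<Rightarrow> ('k \<Rightarrow> nat \<Rightarrow> real) \<Rightarrow> (real^'k) pmf" where
  "score_pmf I n cnt r w \<gamma> \<delta> u =
     map_pmf (\<lambda>Z. \<chi> k. sign_score I (w k) (cell_count (n k) (r k) (Z k)))
       (Pi_pmf UNIV undefined (\<lambda>k. treatment_pmf I (n k) (cnt k) \<gamma> \<delta> (u k)))"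

definition score_bar_pmf ::
    "nat \<Rightarrow> ('k::finite \<Rightarrow> nat) \<Rightarrow> ('k \<Rightarrow> nat \<Rightarrow> nat) \<Rightarrow> ('k \<Rightarrow> nat \<Rightarrow> nat) \<Rightarrow> ('k \<Rightarrow> nat \<Rightarrow> real)
       \<Rightarrow> real \<Rightarrow> (nat \<Rightarrow> real) \<Rightarrow> (real^'k) pmf" where
  "score_bar_pmf I n cnt r w \<gamma> \<delta> =
     map_pmf (\<lambda>M. \<chi> k. sign_score I (w k) (M k))
       (Pi_pmf UNIV undefined
         (\<lambda>k. ext_hypergeometric_pmf I (cnt k) (outcome_count (n k) (r k)) (\<lambda>i. \<gamma> * \<delta> i)))"

definition is_max_over :: "('a \<Rightarrow> real) \<Rightarrow> 'a set \<Rightarrow> real \<Rightarrow> bool" where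
  "is_max_over f A m \<longleftrightarrow> (\<exists>x\<in>A. f x = m) \<and> (\<forall>x\<in>A. f x \<le> m)"

text \<open>Only the entries \<open>u k s\<close> for subjects \<open>s \<in> {1..n k}\<close> matter.\<close>

definition confounders :: "('k \<Rightarrow> nat) \<Rightarrow> ('k \<Rightarrow> nat \<Rightarrow> real) set" where
  "confounders n = {u. \<forall>k. \<forall>s\<in>{1..n k}. u k s \<in> {0..1}}"

text \<open>
  The identity for the worst case needs the treatments with \<open>\<delta> = 1\<close> to carry scores at least as large
  as those with \<open>\<delta> = 0\<close>. It fails, for instance, for one stratum with one subject per treatment,
  \<open>r = (2, 1)\<close>, \<open>w = (0, 1)\<close>, \<open>\<delta> = (1, 0)\<close> and \<open>\<gamma> = 1\<close>: the event \<open>T \<ge> 1\<close> has probability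
  \<open>exp 1 / (1 + exp 1)\<close> at \<open>u = (0, 1)\<close>, but the extended hypergeometric law gives it \<open>1 / (1 + exp 1)\<close>.
\<close>

end

theory Submission
  imports Defs
begin

text \<open>
  In one stratum, the probability of a treatment vector depends only on the set \<open>A\<close> of subjects
  whose treatment has \<open>\<delta> = 1\<close>: it is proportional to the product of the weights \<open>exp (\<gamma> * u s)\<close> over
  \<open>A\<close>, and \<open>A\<close> has a fixed size \<open>m\<close>. Let \<open>R\<close> be the set of subjects with outcome 2. Given \<open>A\<close>, the
  treatment vector is uniform, so by symmetry the law of the score depends only on the size of
  \<open>A \<inter> R\<close>; exchanging the treatments of two subjects shows that it increases stochastically with
  that size. The size of \<open>A \<inter> R\<close> has weights proportional to products of elementary symmetric
  polynomials \<open>e\<^sub>j\<close> and is largest in the likelihood ratio order when \<open>u\<close> is the indicator of \<open>R\<close>,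
  because \<open>(j + 1) e\<^sub>j\<^sub>+\<^sub>1\<close> of \<open>n\<close> variables lies between \<open>(n - j) e\<^sub>j\<close> times the smallest and the largest variable.
  For this \<open>u\<close> the vector of cell counts is extended hypergeometric, by counting treatment vectors
  with prescribed cells. Finally, stochastic dominance in each stratum passes to increasing events
  of the independent product, one coordinate at a time.
\<close>

subsection \<open>Elementary symmetric polynomials and weighted subsets\<close>

definition esym :: "('a \<Rightarrow> real) \<Rightarrow> 'a set \<Rightarrow> nat \<Rightarrow> real" where
  "esym v S k = (\<Sum>A | A \<subseteq> S \<and> card A = k. \<Prod>s\<in>A. v s)"

lemma esym_nonneg:
  assumes "\<And>s. s \<in> S \<Longrightarrow> 0 \<le> v s"
  shows "0 \<le> esym v S k"
  unfolding esym_def using assms by (intro sum_nonneg prod_nonneg) auto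

text \<open>Double counting of the pairs \<open>(A, x)\<close> with \<open>x\<close> in
  \<open>A\<close>: such a pair is the same as a set \<open>B = A - {x}\<close> together with a
  point outside \<open>B\<close>.\<close>

lemma esym_Suc:
  assumes "finite S"
  shows "real (Suc k) * esym v S (Suc k)
    = (\<Sum>B | B \<subseteq> S \<and> card B = k. (\<Prod>s\<in>B. v s) * (\<Sum>s\<in>S - B. v s))"
proof -
  have fin: "finite {A. A \<subseteq> S \<and> card A = j}" for j
    using assms by simp
  have finA: "finite A" if "A \<subseteq> S" for A
    using that assms finite_subset by blast
  have "real (Suc k) * esym v S (Suc k)
      = (\<Sum>A | A \<subseteq> S \<and> card A = Suc k. \<Sum>x\<in>A. \<Prod>s\<in>A. v s)"
    unfolding esym_def sum_distrib_left by (intro sum.cong) auto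
  also have "\<dots> = (\<Sum>(A, x)\<in>(SIGMA A:{A. A \<subseteq> S \<and> card A = Suc k}. A). \<Prod>s\<in>A. v s)"
    using fin finA by (subst sum.Sigma) auto
  also have "\<dots> = (\<Sum>(B, x)\<in>(SIGMA B:{B. B \<subseteq> S \<and> card B = k}. S - B). (\<Prod>s\<in>B. v s) * v x)"
  proof (rule sum.reindex_bij_witness[where i = "\<lambda>(B, x). (insert x B, x)" and j = "\<lambda>(A, x). (A - {x}, x)"],
      goal_cases)
    case (5 a)
    then obtain A x where a: "a = (A, x)" "A \<subseteq> S" "card A = Suc k" "x \<in> A"
      by auto
    then show ?case
      using prod.remove[of A x v] finA by (simp add: mult.commute)
  qed (auto simp: finA card_insert_if)
  also have "\<dots> = (\<Sum>B | B \<subseteq> S \<and> card B = k. \<Sum>x\<in>S - B. (\<Prod>s\<in>B. v s) * v x)"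
    using fin assms by (subst sum.Sigma) auto
  finally show ?thesis
    by (simp add: sum_distrib_left)
qed

text \<open>In \<open>esym_Suc\<close>, each of the \<open>card S - k\<close> variables outside
  \<open>B\<close> is at most \<open>c\<close>.\<close>

lemma esym_Suc_le:
  assumes "finite S" and v: "\<And>s. s \<in> S \<Longrightarrow> 0 \<le> v s \<and> v s \<le> c"
  shows "real (Suc k) * esym v S (Suc k) \<le> real (card S - k) * c * esym v S k"
proof -
  have "(\<Prod>s\<in>B. v s) * (\<Sum>s\<in>S - B. v s) \<le> (\<Prod>s\<in>B. v s) * (real (card S - k) * c)"
    if B: "B \<subseteq> S" "card B = k" for B
  proof (rule mult_left_mono)
    have "(\<Sum>s\<in>S - B. v s) \<le> real (card (S - B)) * c"
      using v by (intro sum_bounded_above) auto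
    then show "(\<Sum>s\<in>S - B. v s) \<le> real (card S - k) * c"
      using B assms(1) finite_subset[OF B(1)] by (simp add: card_Diff_subset)
  qed (use v B in \<open>auto intro!: prod_nonneg\<close>)
  then show ?thesis
    unfolding esym_Suc[OF assms(1)]
    by (subst esym_def) (auto simp: sum_distrib_left mult_ac intro!: sum_mono)
qed

lemma esym_Suc_ge:
  assumes "finite S" and v: "\<And>s. s \<in> S \<Longrightarrow> c \<le> v s" and c: "0 \<le> c"
  shows "real (card S - k) * c * esym v S k \<le> real (Suc k) * esym v S (Suc k)"
proof -
  have "(\<Prod>s\<in>B. v s) * (real (card S - k) * c) \<le> (\<Prod>s\<in>B. v s) * (\<Sum>s\<in>S - B. v s)"
    if B: "B \<subseteq> S" "card B = k" for B
  proof (rule mult_left_mono)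
    have "real (card (S - B)) * c \<le> (\<Sum>s\<in>S - B. v s)"
      using v by (intro sum_bounded_below) auto
    then show "real (card S - k) * c \<le> (\<Sum>s\<in>S - B. v s)"
      using B assms(1) finite_subset[OF B(1)] by (simp add: card_Diff_subset)
    show "0 \<le> (\<Prod>s\<in>B. v s)"
      using v B c by (intro prod_nonneg) (meson order.trans subsetD)
  qed
  then show ?thesis
    unfolding esym_Suc[OF assms(1)]
    by (subst esym_def) (auto simp: sum_distrib_left mult_ac intro!: sum_mono)
qed

text \<open>The step ratio of \<open>a\<close> is at most \<open>x j / (j + 1)\<close> and that of
  \<open>b\<close> at least this, so \<open>b / a\<close> grows with the index. Cross multiplication
  also covers zero values of \<open>a\<close> and \<open>b\<close>.\<close>

lemma ratio_le_chain:
  fixes a b :: "nat \<Rightarrow> real"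
  assumes step_a: "\<And>j. real (Suc j) * a (Suc j) \<le> x j * a j"
    and step_b: "\<And>j. real (Suc j) * b (Suc j) \<ge> x j * b j"
    and nonneg: "\<And>j. 0 \<le> a j" "\<And>j. 0 \<le> b j" "\<And>j. 0 \<le> x j"
    and "k \<le> j"
  shows "a j * b k \<le> a k * b j"
  using \<open>k \<le> j\<close>
proof (induction j rule: dec_induct)
  case (step j)
  have "real (Suc j) * (a (Suc j) * b k) = (real (Suc j) * a (Suc j)) * b k"
    by (simp only: mult_ac)
  also have "\<dots> \<le> x j * a j * b k"
    using step_a nonneg by (intro mult_right_mono) auto
  also have "\<dots> = x j * (a j * b k)"
    by (simp only: mult_ac)
  also have "\<dots> \<le> x j * (a k * b j)"
    using step.IH nonneg by (intro mult_left_mono) auto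
  also have "\<dots> = a k * (x j * b j)"
    by (simp only: mult_ac)
  also have "\<dots> \<le> a k * (real (Suc j) * b (Suc j))"
    using step_b nonneg by (intro mult_left_mono) auto
  also have "\<dots> = real (Suc j) * (a k * b (Suc j))"
    by (simp only: mult_ac)
  finally show ?case
    by (simp only: mult_le_cancel_left_pos of_nat_0_less_iff zero_less_Suc)
qed simp

text \<open>The constant \<open>c\<close> separates the two families of variables, so the upper step
  bound for \<open>v\<close> and the lower one for \<open>v'\<close> have the same factor
  \<open>(card S - j) * c\<close>.\<close>

lemma esym_ratio_le:
  assumes "finite S" "\<And>s. s \<in> S \<Longrightarrow> 0 \<le> v s \<and> v s \<le> c \<and> c \<le> v' s" and "k \<le> j" and c: "0 \<le> c"
  shows "esym v S j * esym v' S k \<le> esym v S k * esym v' S j"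
proof (rule ratio_le_chain[where x = "\<lambda>j. real (card S - j) * c"])
  show "real (Suc j) * esym v S (Suc j) \<le> real (card S - j) * c * esym v S j" for j
    using assms by (intro esym_Suc_le) auto
  show "real (card S - j) * c * esym v' S j \<le> real (Suc j) * esym v' S (Suc j)" for j
    using assms by (intro esym_Suc_ge) auto
  show "0 \<le> esym v S j" "0 \<le> esym v' S j" for j
    using assms by (auto intro!: esym_nonneg intro: order.trans)
qed (use assms in auto)

text \<open>A set \<open>A\<close> is determined by the disjoint pieces \<open>A \<inter> R\<close>
  and \<open>A - R\<close>, and its product of weights factors accordingly.\<close>

lemma sum_subsets_split:
  fixes F :: "nat \<Rightarrow> real"
  assumes "finite S" "R \<subseteq> S"
  shows "(\<Sum>A | A \<subseteq> S \<and> card A = m. F (card (A \<inter> R)) * (\<Prod>s\<in>A. v s))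
    = (\<Sum>j\<le>m. F j * (esym v R j * esym v (S - R) (m - j)))"
proof -
  have finR: "finite R" using assms finite_subset by blast
  let ?P = "\<lambda>S k. {A. A \<subseteq> S \<and> card A = k}"
  have fin: "finite (?P T k)" if "T \<subseteq> S" for T k
    using finite_subset[OF that assms(1)] by simp
  have "(\<Sum>j\<le>m. F j * (esym v R j * esym v (S - R) (m - j)))
      = (\<Sum>j\<le>m. \<Sum>(B, C)\<in>?P R j \<times> ?P (S - R) (m - j). F j * ((\<Prod>s\<in>B. v s) * (\<Prod>s\<in>C. v s)))"
    unfolding esym_def sum_product sum.cartesian_product
    by (simp add: sum_distrib_left case_prod_unfold)
  also have "\<dots> = (\<Sum>(j, B, C)\<in>(SIGMA j:{..m}. ?P R j \<times> ?P (S - R) (m - j)).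
      F j * ((\<Prod>s\<in>B. v s) * (\<Prod>s\<in>C. v s)))"
    using fin assms by (subst sum.Sigma) auto
  also have "\<dots> = (\<Sum>A\<in>?P S m. F (card (A \<inter> R)) * (\<Prod>s\<in>A. v s))"
  proof (rule sum.reindex_bij_witness[where j = "\<lambda>(j, B, C). B \<union> C"
        and i = "\<lambda>A. (card (A \<inter> R), A \<inter> R, A - R)"], goal_cases)
    case (1 a)
    then obtain j B C where a: "a = (j, B, C)" "B \<subseteq> R" "C \<subseteq> S - R" "card B = j" by auto
    moreover have "(B \<union> C) \<inter> R = B" "(B \<union> C) - R = C" using a by auto
    ultimately show ?case by simp
  next
    case (2 a)
    then obtain j B C where a: "a = (j, B, C)" "B \<subseteq> R" "C \<subseteq> S - R" "card B = j" "card C = m - j" "j \<le> m"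
      by auto
    have "finite B" "finite C" using a finR assms by (auto intro: finite_subset)
    moreover have "B \<inter> C = {}" using a by auto
    ultimately show ?case using a assms by (auto simp: card_Un_disjoint)
  next
    case (4 A)
    then have "finite A" using assms by (auto intro: finite_subset)
    then have "card A = card (A \<inter> R) + card (A - R)"
      by (metis card_Int_Diff)
    then show ?case using 4 by auto
  next
    case (5 a)
    then obtain j B C where a: "a = (j, B, C)" "B \<subseteq> R" "C \<subseteq> S - R" "card B = j" by auto
    have "finite B" "finite C" using a finR assms by (auto intro: finite_subset)
    moreover have "B \<inter> C = {}" "(B \<union> C) \<inter> R = B" using a by auto
    ultimately show ?case using a by (simp add: prod.union_disjoint)
  qed auto
  finally show ?thesis ..
qed

text \<open>Chebyshev's argument: the difference of the sides is a double sum over pairs, and adding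
  the terms for \<open>(j, k)\<close> and \<open>(k, j)\<close> gives a product of two factors that
  do not have opposite signs.\<close>

lemma mono_likelihood_ratio_sum_le:
  fixes F V W :: "'a::linorder \<Rightarrow> real"
  assumes "mono F" and ratio: "\<And>j k. j \<in> J \<Longrightarrow> k \<in> J \<Longrightarrow> k \<le> j \<Longrightarrow> W j * V k \<le> W k * V j"
  shows "(\<Sum>j\<in>J. F j * W j) * (\<Sum>j\<in>J. V j) \<le> (\<Sum>j\<in>J. F j * V j) * (\<Sum>j\<in>J. W j)"
proof -
  have swap: "(\<Sum>j\<in>J. \<Sum>k\<in>J. G k j) = (\<Sum>j\<in>J. \<Sum>k\<in>J. G j k)" for G :: "'a \<Rightarrow> 'a \<Rightarrow> real"
    by (rule sum.swap)
  let ?D = "\<lambda>j k. F j * (V j * W k - W j * V k)"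
  have "0 \<le> ?D j k + ?D k j" if "j \<in> J" "k \<in> J" for j k
  proof -
    have "?D j k + ?D k j = (F j - F k) * (V j * W k - W j * V k)"
      by (simp add: algebra_simps)
    also have "\<dots> \<ge> 0"
    proof (cases "k \<le> j")
      case True
      then show ?thesis
        using ratio[of j k] that monoD[OF \<open>mono F\<close> True]
        by (intro mult_nonneg_nonneg) (auto simp: mult_ac)
    next
      case False
      then show ?thesis
        using ratio[of k j] that monoD[OF \<open>mono F\<close>, of j k]
        by (intro mult_nonpos_nonpos) (auto simp: mult_ac)
    qed
    finally show ?thesis .
  qed
  then have "0 \<le> (\<Sum>j\<in>J. \<Sum>k\<in>J. ?D j k + ?D k j)"
    by (intro sum_nonneg) auto
  also have "\<dots> = 2 * (\<Sum>j\<in>J. \<Sum>k\<in>J. ?D j k)"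
    by (simp add: sum.distrib swap[of ?D])
  also have "(\<Sum>j\<in>J. \<Sum>k\<in>J. ?D j k)
      = (\<Sum>j\<in>J. F j * V j) * (\<Sum>j\<in>J. W j) - (\<Sum>j\<in>J. F j * W j) * (\<Sum>j\<in>J. V j)"
    unfolding sum_product by (simp add: sum_subtractf right_diff_distrib mult.assoc)
  finally show ?thesis
    by simp
qed

text \<open>
  With \<open>Q = S - R\<close>, the weight of the \<open>m\<close>-subsets that meet \<open>R\<close> in \<open>j\<close> points is \<open>e\<^sub>j(R) e\<^sub>m\<^sub>-\<^sub>j(Q)\<close>.
  Raising the weights on \<open>R\<close> to their maximum and lowering those on \<open>Q\<close> to their minimum
  increases the ratio of this product at any two values \<open>j > k\<close>.
\<close>

lemma weighted_subsets_dominance: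
  fixes F :: "nat \<Rightarrow> real" and m :: nat
  assumes S: "finite S" "R \<subseteq> S" and "mono F"
    and v: "\<And>s. s \<in> S \<Longrightarrow> l \<le> v s \<and> v s \<le> h" and "0 \<le> l"
  defines "v' \<equiv> \<lambda>s. if s \<in> R then h else l"
  defines "P \<equiv> {A. A \<subseteq> S \<and> card A = m}"
  shows "(\<Sum>A\<in>P. F (card (A \<inter> R)) * (\<Prod>s\<in>A. v s)) * (\<Sum>A\<in>P. \<Prod>s\<in>A. v' s)
    \<le> (\<Sum>A\<in>P. F (card (A \<inter> R)) * (\<Prod>s\<in>A. v' s)) * (\<Sum>A\<in>P. \<Prod>s\<in>A. v s)"
proof -
  let ?w = "\<lambda>v j. esym v R j * esym v (S - R) (m - j)"
  have nn: "0 \<le> v s" "0 \<le> v' s" if "s \<in> S" for s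
    using v[OF that] \<open>0 \<le> l\<close> by (auto simp: v'_def)
  have ratio: "?w v j * ?w v' k \<le> ?w v k * ?w v' j" if "k \<le> j" for j k
  proof (cases "S = {}")
    case True
    then show ?thesis using S that by (auto simp: esym_def mult_ac)
  next
    case False
    \<comment> \<open>The bounds \<open>l\<close> and \<open>h\<close> are comparable only through
      an element of \<open>S\<close>.\<close>
    have "0 \<le> h" using False v \<open>0 \<le> l\<close> by (meson all_not_in_conv order.trans)
    have "esym v R j * esym v' R k \<le> esym v R k * esym v' R j"
      using S v nn that \<open>0 \<le> h\<close>
      by (intro esym_ratio_le[where c = h]) (auto simp: v'_def subset_iff intro: finite_subset)
    \<comment> \<open>On \<open>S - R\<close> the roles are reversed: \<open>v'\<close> is the
      smaller family, and \<open>k \<le> j\<close> gives \<open>m - j \<le> m - k\<close>.\<close>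
    moreover have "esym v' (S - R) (m - k) * esym v (S - R) (m - j)
        \<le> esym v' (S - R) (m - j) * esym v (S - R) (m - k)"
      using S v nn that \<open>0 \<le> l\<close>
      by (intro esym_ratio_le[where c = l]) (auto simp: v'_def)
    ultimately have "(esym v R j * esym v' R k) * (esym v' (S - R) (m - k) * esym v (S - R) (m - j))
        \<le> (esym v R k * esym v' R j) * (esym v' (S - R) (m - j) * esym v (S - R) (m - k))"
      by (rule mult_mono) (use nn S in \<open>auto intro!: mult_nonneg_nonneg esym_nonneg\<close>)
    then show ?thesis by (simp only: mult_ac)
  qed
  have eq: "(\<Sum>A\<in>P. G (card (A \<inter> R)) * (\<Prod>s\<in>A. x s)) = (\<Sum>j\<le>m. G j * ?w x j)"
    for G :: "nat \<Rightarrow> real" and x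
    unfolding P_def using S by (rule sum_subsets_split)
  have eq1: "(\<Sum>A\<in>P. (\<Prod>s\<in>A. x s)) = (\<Sum>j\<le>m. ?w x j)" for x
    using eq[of "\<lambda>_. 1" x] by simp
  show ?thesis
    unfolding eq eq1 using \<open>mono F\<close> ratio by (rule mono_likelihood_ratio_sum_le)
qed

subsection \<open>Exchange and counting arguments\<close>

text \<open>\<open>A\<close> is carried to \<open>A'\<close> by replacing, one at a time, a point of
  \<open>A - A'\<close> by a point of \<open>A' - A\<close>, never one in \<open>R\<close> by one
  outside \<open>R\<close>. The induction is on the size of \<open>A - A'\<close>.\<close>

lemma exchange_mono:
  fixes h :: "'a set \<Rightarrow> 'b::preorder"
  assumes "finite S"
    and step: "\<And>A p q. A \<subseteq> S \<Longrightarrow> q \<in> A \<Longrightarrow> p \<in> S - A \<Longrightarrow> (q \<in> R \<Longrightarrow> p \<in> R) \<Longrightarrow> h A \<le> h (insert p (A - {q}))"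
    and A: "A \<subseteq> S" "A' \<subseteq> S" "card A = card A'" "card (A \<inter> R) \<le> card (A' \<inter> R)"
  shows "h A \<le> h A'"
proof -
  have fin: "finite X" if "X \<subseteq> S" for X
    using that \<open>finite S\<close> finite_subset by blast
  have split: "card X = card (X - Y) + card (X \<inter> Y)" if "finite X" for X Y :: "'a set"
    using card_Int_Diff[OF that, of Y] by simp
  have "h A \<le> h A'"
    if "card (A - A') = n" "A \<subseteq> S" "card (A' - A) = card (A - A')"
      "card ((A - A') \<inter> R) \<le> card ((A' - A) \<inter> R)" for n A
    using that
  proof (induction n arbitrary: A)
    case 0
    then have "card (A - A') = 0" "card (A' - A) = 0"
      by linarith+
    then have "A = A'"
      using fin[OF 0(2)] fin[OF A(2)] by (metis Diff_eq_empty_iff card_0_eq finite_Diff subset_antisym)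
    then show ?case
      by simp
  next
    case (Suc n)
    let ?X = "A - A'" and ?Y = "A' - A"
    have finXY: "finite ?X" "finite ?Y"
      using Suc.prems(2) A(2) fin by auto
    have ne: "?X \<noteq> {}" "?Y \<noteq> {}"
      using Suc.prems(1,3) by (metis card.empty nat.distinct(1))+
    \<comment> \<open>The pair must also keep the inequality between the parts in \<open>R\<close>.
      If \<open>?X\<close> lies in \<open>R\<close>, so does \<open>?Y\<close> by counting;
      otherwise \<open>q\<close> is taken outside \<open>R\<close>, and \<open>p\<close> outside
      \<open>R\<close> as well if possible.\<close>
    obtain q p where qp: "q \<in> ?X" "p \<in> ?Y" "q \<in> R \<longrightarrow> p \<in> R"
      and le: "card ((?X - {q}) \<inter> R) \<le> card ((?Y - {p}) \<inter> R)"
    proof (cases "?X \<subseteq> R")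
      case True
      then have "card ?Y \<le> card (?Y \<inter> R)"
        using Suc.prems(3,4) by (simp add: Int_absorb2)
      then have "?Y \<subseteq> R"
        using card_seteq[of ?Y "?Y \<inter> R"] finXY by auto
      with True ne Suc.prems(3) finXY obtain q p where "q \<in> ?X" "p \<in> ?Y" "q \<in> R" "p \<in> R"
        by blast
      moreover have "(?X - {q}) \<inter> R = ?X - {q}" "(?Y - {p}) \<inter> R = ?Y - {p}"
        using True \<open>?Y \<subseteq> R\<close> by auto
      ultimately show ?thesis
        using that[of q p] Suc.prems(3) finXY by simp
    next
      case False
      then obtain q where q: "q \<in> ?X" "q \<notin> R"
        by blast
      then have Xq: "(?X - {q}) \<inter> R = ?X \<inter> R"
        by auto
      show ?thesis
      proof (cases "?Y \<subseteq> R")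
        case True
        with ne obtain p where p: "p \<in> ?Y" "p \<in> R"
          by blast
        have "?X \<inter> R \<subset> ?X"
          using q by auto
        then have "card (?X \<inter> R) < card ?X"
          using finXY psubset_card_mono by blast
        moreover have "(?Y - {p}) \<inter> R = ?Y - {p}"
          using True by auto
        ultimately show ?thesis
          using that[of q p] q p Xq Suc.prems(3) finXY by simp
      next
        case False
        then obtain p where p: "p \<in> ?Y" "p \<notin> R"
          by blast
        then have "(?Y - {p}) \<inter> R = ?Y \<inter> R"
          by auto
        then show ?thesis
          using that[of q p] q p Xq Suc.prems(4) by simp
      qed
    qed
    let ?A = "insert p (A - {q})"
    have eq: "?A - A' = ?X - {q}" "A' - ?A = ?Y - {p}"
      using qp by auto
    have "h A \<le> h ?A"
      using qp A(2) Suc.prems(2) by (intro step) auto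
    also have "h ?A \<le> h A'"
    proof (rule Suc.IH)
      show "card (?A - A') = n"
        unfolding eq using Suc.prems(1) qp finXY by simp
      show "card (A' - ?A) = card (?A - A')"
        unfolding eq using Suc.prems(3) qp finXY by simp
      show "card ((?A - A') \<inter> R) \<le> card ((A' - ?A) \<inter> R)"
        unfolding eq by (rule le)
    qed (use qp A(2) Suc.prems(2) in auto)
    finally show ?case .
  qed
  moreover have "card (A' - A) = card (A - A')"
    using A split[of A A'] split[of A' A] fin by (simp add: Int_commute)
  moreover have "card ((A - A') \<inter> R) \<le> card ((A' - A) \<inter> R)"
  proof -
    have "A \<inter> R - A' = (A - A') \<inter> R" "A' \<inter> R - A = (A' - A) \<inter> R"
      "A \<inter> R \<inter> A' = A' \<inter> R \<inter> A"
      by auto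
    then show ?thesis
      using A split[of "A \<inter> R" A'] split[of "A' \<inter> R" A] fin by simp
  qed
  ultimately show ?thesis
    using A(1) by blast
qed

text \<open>The multinomial coefficient, in a form without division. The induction removes a point
  \<open>x\<close> and sums over the value it takes.\<close>

lemma card_fibres:
  assumes "finite S" "finite J" "(\<Sum>i\<in>J. t i) = card S"
  shows "card {z \<in> S \<rightarrow>\<^sub>E J. \<forall>i\<in>J. card {s\<in>S. z s = i} = t i} * (\<Prod>i\<in>J. fact (t i)) = (fact (card S) :: nat)"
  using assms(1,3)
proof (induction S arbitrary: t rule: finite_induct)
  case empty
  then have "t i = 0" if "i \<in> J" for i
    using that assms(2) by simp
  moreover from this have "{z \<in> {} \<rightarrow>\<^sub>E J. \<forall>i\<in>J. card {s\<in>{}. z s = i} = t i} = {\<lambda>_. undefined}"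
    by auto
  ultimately show ?case
    by simp
next
  case (insert x S)
  \<comment> \<open>The summand \<open>of_bool (j = i)\<close> accounts for \<open>x\<close> in the
    fibre of \<open>i\<close>; unlike the truncated \<open>t i - 1\<close>, it makes
    \<open>?C i\<close> empty when \<open>t i = 0\<close>.\<close>
  let ?C = "\<lambda>i. {z \<in> S \<rightarrow>\<^sub>E J. \<forall>j\<in>J. card {s\<in>S. z s = j} + of_bool (j = i) = t j}"
  let ?Z = "{z \<in> insert x S \<rightarrow>\<^sub>E J. \<forall>i\<in>J. card {s\<in>insert x S. z s = i} = t i}"
  have fibre: "card {s\<in>insert x S. (z(x := i)) s = j} = card {s\<in>S. z s = j} + of_bool (j = i)" for z i j
  proof -
    have "{s\<in>insert x S. (z(x := i)) s = j} = (if j = i then insert x {s\<in>S. z s = j} else {s\<in>S. z s = j})"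
      using insert.hyps by auto
    then show ?thesis
      using insert.hyps by simp
  qed
  have "bij_betw (\<lambda>(i, z). z(x := i)) (SIGMA i:J. ?C i) ?Z"
  proof (rule bij_betw_imageI)
    show "inj_on (\<lambda>(i, z). z(x := i)) (SIGMA i:J. ?C i)"
    proof (rule inj_onI, clarsimp)
      fix i z i' z'
      assume z: "z \<in> S \<rightarrow>\<^sub>E J" "z' \<in> S \<rightarrow>\<^sub>E J" and eq: "z(x := i) = z'(x := i')"
      have "z y = z' y" for y
        using fun_cong[OF eq, of y] z insert.hyps by (cases "y = x") (auto simp: PiE_def extensional_def)
      then show "i = i' \<and> z = z'"
        using fun_cong[OF eq, of x] by auto
    qed
    show "(\<lambda>(i, z). z(x := i)) ` (SIGMA i:J. ?C i) = ?Z"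
    proof (intro equalityI subsetI)
      fix y assume "y \<in> (\<lambda>(i, z). z(x := i)) ` (SIGMA i:J. ?C i)"
      then obtain i z where y: "y = z(x := i)" and iz: "i \<in> J" "z \<in> ?C i"
        by auto
      have "y \<in> insert x S \<rightarrow>\<^sub>E J"
        using iz unfolding y by (intro PiE_fun_upd) auto
      moreover have "\<forall>j\<in>J. card {s\<in>insert x S. y s = j} = t j"
        using iz unfolding y fibre by simp
      ultimately show "y \<in> ?Z"
        by blast
    next
      fix y assume y: "y \<in> ?Z"
      then obtain i z where iz: "i \<in> J" "z \<in> S \<rightarrow>\<^sub>E J" "y = z(x := i)"
        unfolding PiE_insert_eq by auto
      then have "z \<in> ?C i"
        using y unfolding iz(3) mem_Collect_eq fibre by blast
      then show "y \<in> (\<lambda>(i, z). z(x := i)) ` (SIGMA i:J. ?C i)"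
        using iz by force
    qed
  qed
  then have "card ?Z = card (SIGMA i:J. ?C i)"
    by (simp add: bij_betw_same_card)
  also have "\<dots> = (\<Sum>i\<in>J. card (?C i))"
    using assms(2) insert.hyps by (subst card_SigmaI) (auto intro!: finite_PiE)
  finally have "card ?Z * (\<Prod>i\<in>J. fact (t i)) = (\<Sum>i\<in>J. card (?C i) * (\<Prod>i\<in>J. fact (t i)))"
    by (simp add: sum_distrib_right)
  \<comment> \<open>Lowering \<open>t i\<close> by one splits the factor \<open>t i\<close> off
    \<open>fact (t i)\<close>; these factors then add up to \<open>Suc (card S)\<close>.\<close>
  also have "\<dots> = (\<Sum>i\<in>J. t i * fact (card S))"
  proof (rule sum.cong)
    fix i assume i: "i \<in> J"
    show "card (?C i) * (\<Prod>i\<in>J. fact (t i)) = t i * fact (card S)"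
    proof (cases "t i")
      case 0
      then have C: "?C i = {}"
        using i by auto
      show ?thesis
        unfolding C using 0 by simp
    next
      case (Suc k)
      let ?t = "t(i := k)"
      have C: "?C i = {z \<in> S \<rightarrow>\<^sub>E J. \<forall>j\<in>J. card {s\<in>S. z s = j} = ?t j}"
        using Suc by (intro Collect_cong conj_cong ball_cong refl) auto
      have "(\<Sum>j\<in>J. t j) = Suc (\<Sum>j\<in>J. ?t j)"
        using i assms(2) Suc by (simp add: sum.remove[of J i])
      then have "card (?C i) * (\<Prod>j\<in>J. fact (?t j)) = fact (card S)"
        unfolding C using insert by (intro insert.IH) auto
      moreover have "(\<Prod>j\<in>J. fact (t j) :: nat) = t i * (\<Prod>j\<in>J. fact (?t j))"
        using i assms(2) Suc by (simp add: prod.remove[of J i] algebra_simps)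
      ultimately show ?thesis
        by (simp only: mult_ac)
    qed
  qed simp
  also have "\<dots> = fact (card (insert x S))"
    using insert by (simp flip: sum_distrib_right)
  finally show ?case .
qed

lemma bij_betw_restrict_Un:
  assumes "A \<inter> B = {}"
  shows "bij_betw (\<lambda>f. (restrict f A, restrict f B)) (A \<union> B \<rightarrow>\<^sub>E C) ((A \<rightarrow>\<^sub>E C) \<times> (B \<rightarrow>\<^sub>E C))"
proof (rule bij_betw_byWitness[where f' = "\<lambda>(f, g) x. if x \<in> A then f x else g x"])
  show "\<forall>f\<in>A \<union> B \<rightarrow>\<^sub>E C. (\<lambda>(f, g) x. if x \<in> A then f x else g x) (restrict f A, restrict f B) = f"
    by (fastforce simp: fun_eq_iff PiE_iff extensional_def)
  have "restrict (\<lambda>x. if x \<in> A then f x else g x) A = f" "restrict (\<lambda>x. if x \<in> A then f x else g x) B = g"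
    if "f \<in> A \<rightarrow>\<^sub>E C" "g \<in> B \<rightarrow>\<^sub>E C" for f g
    using that assms by (auto simp: fun_eq_iff PiE_iff extensional_def)
  then show "\<forall>y\<in>(A \<rightarrow>\<^sub>E C) \<times> (B \<rightarrow>\<^sub>E C). (restrict ((\<lambda>(f, g) x. if x \<in> A then f x else g x) y) A,
      restrict ((\<lambda>(f, g) x. if x \<in> A then f x else g x) y) B) = y"
    by auto
qed (auto simp: PiE_iff extensional_def)

subsection \<open>Weighted distributions and products\<close>

lemma measure_weighted_pmf:
  assumes "finite S" "\<And>x. x \<in> S \<Longrightarrow> 0 \<le> f x" "0 < sum f S"
  shows "measure_pmf.prob (weighted_pmf S f) X = (\<Sum>x\<in>{x\<in>S. x \<in> X}. f x) / sum f S"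
proof -
  have "set_pmf (weighted_pmf S f) \<subseteq> S"
    using pmf_weighted_pmf[OF assms] by (auto simp: set_pmf_iff split: if_splits)
  then have "measure_pmf.prob (weighted_pmf S f) X = measure_pmf.prob (weighted_pmf S f) {x\<in>S. x \<in> X}"
    by (intro measure_pmf.finite_measure_eq_AE) (auto simp: AE_measure_pmf_iff)
  also have "\<dots> = (\<Sum>x\<in>{x\<in>S. x \<in> X}. f x / sum f S)"
    using assms pmf_weighted_pmf[OF assms] by (simp add: measure_measure_pmf_finite)
  finally show ?thesis
    by (simp add: sum_divide_distrib)
qed

text \<open>Fibre sums need to match the target weights only up to a common factor \<open>c\<close>,
  which cancels in the normalisation.\<close>

lemma map_weighted_pmf:
  assumes S: "finite S" "\<And>x. x \<in> S \<Longrightarrow> 0 \<le> f x" "0 < sum f S"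
    and T: "finite T" "h ` S \<subseteq> T" and "0 < c"
    and fibre: "\<And>t. t \<in> T \<Longrightarrow> (\<Sum>x\<in>{x\<in>S. h x = t}. f x) = c * g t"
  shows "map_pmf h (weighted_pmf S f) = weighted_pmf T g"
proof (rule pmf_eqI)
  fix t
  have "sum f S = c * sum g T"
    unfolding sum.group[OF S(1) T, of f, symmetric] by (simp add: fibre sum_distrib_left)
  moreover from this have "0 < sum g T"
    using S(3) \<open>0 < c\<close> by (simp add: zero_less_mult_iff)
  moreover have "0 \<le> g t" if "t \<in> T" for t
  proof -
    have "0 \<le> c * g t"
      unfolding fibre[OF that, symmetric] using S by (intro sum_nonneg) auto
    then show ?thesis
      using \<open>0 < c\<close> by (simp add: zero_le_mult_iff)
  qed
  moreover have "(\<Sum>x\<in>{x \<in> S. h x = t}. f x) = 0" if "t \<notin> T"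
    using that T(2) by (intro sum.neutral) auto
  ultimately show "pmf (map_pmf h (weighted_pmf S f)) t = pmf (weighted_pmf T g) t"
    using T \<open>0 < c\<close> fibre[of t]
    by (cases "t \<in> T") (simp_all add: pmf_map measure_weighted_pmf[OF S] pmf_weighted_pmf vimage_def)
qed

text \<open>The map may vary with the index, and the two defaults may differ because coordinates
  outside \<open>A\<close> are reset to \<open>d\<close>.\<close>

lemma Pi_pmf_map_dep:
  assumes "finite A"
  shows "Pi_pmf A d (\<lambda>k. map_pmf (h k) (p k)) = map_pmf (\<lambda>f k. if k \<in> A then h k (f k) else d) (Pi_pmf A d' p)"
  unfolding map_pmf_def using assms by (simp add: Pi_pmf_bind[where d' = d'] Pi_pmf_return_pmf)

definition upset :: "'a::order set \<Rightarrow> bool" where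
  "upset U \<longleftrightarrow> (\<forall>x\<in>U. \<forall>y\<ge>x. y \<in> U)"

text \<open>Induction on \<open>A\<close>, replacing \<open>p\<close> by \<open>q\<close> first on
  the old coordinates with the new one fixed, then on the new one with the others fixed. Sections of
  an increasing event are increasing.\<close>

lemma Pi_pmf_upset_le:
  fixes p q :: "'k \<Rightarrow> 'a::order pmf"
  assumes "finite A"
    and le: "\<And>k U. k \<in> A \<Longrightarrow> upset U \<Longrightarrow> measure_pmf.prob (p k) U \<le> measure_pmf.prob (q k) U"
    and "upset V"
  shows "measure_pmf.prob (Pi_pmf A d p) V \<le> measure_pmf.prob (Pi_pmf A d q) V"
proof -
  have "emeasure (Pi_pmf A d p) V \<le> emeasure (Pi_pmf A d q) V"
    using assms
  proof (induction A arbitrary: V rule: finite_induct)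
    case (insert x A)
    have rows: "emeasure (Pi_pmf (insert x A) d p') V
        = (\<integral>\<^sup>+y. emeasure (Pi_pmf A d p') {f. f(x := y) \<in> V} \<partial>p' x)" for p' :: "'k \<Rightarrow> 'a pmf"
      using insert.hyps
      by (simp add: Pi_pmf_insert' vimage_def flip: map_pmf_def)
    \<comment> \<open>Independence allows the coordinate \<open>x\<close> to be drawn last, so that
      its law can be compared for fixed \<open>f\<close>.\<close>
    have cols: "emeasure (bind_pmf p' (\<lambda>y. map_pmf (\<lambda>f. f(x := y)) P)) V
        = (\<integral>\<^sup>+f. emeasure p' {y. f(x := y) \<in> V} \<partial>P)" for p' :: "'a pmf" and P
      unfolding map_pmf_def by (subst bind_commute_pmf) (simp add: vimage_def flip: map_pmf_def)
    have "emeasure (Pi_pmf (insert x A) d p) V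
        \<le> (\<integral>\<^sup>+y. emeasure (Pi_pmf A d q) {f. f(x := y) \<in> V} \<partial>p x)"
      unfolding rows
    proof (intro nn_integral_mono insert.IH)
      show "upset {f. f(x := y) \<in> V}" for y
        using insert.prems(2) unfolding upset_def by (auto simp: le_fun_def)
    qed (use insert.prems(1) in auto)
    also have "\<dots> = (\<integral>\<^sup>+f. emeasure (p x) {y. f(x := y) \<in> V} \<partial>Pi_pmf A d q)"
      using cols[of "p x" "Pi_pmf A d q"] by (simp add: vimage_def)
    also have "\<dots> \<le> (\<integral>\<^sup>+f. emeasure (q x) {y. f(x := y) \<in> V} \<partial>Pi_pmf A d q)"
    proof (rule nn_integral_mono)
      fix f
      have "upset {y. f(x := y) \<in> V}"
        using insert.prems(2) unfolding upset_def by (auto simp: le_fun_def)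
      then show "emeasure (p x) {y. f(x := y) \<in> V} \<le> emeasure (q x) {y. f(x := y) \<in> V}"
        using insert.prems(1)[of x] by (simp add: measure_pmf.emeasure_eq_measure)
    qed
    also have "\<dots> = emeasure (Pi_pmf (insert x A) d q) V"
      using cols[of "q x" "Pi_pmf A d q"] unfolding rows by (simp add: vimage_def)
    finally show ?case .
  qed simp
  then show ?thesis
    by (simp add: measure_pmf.emeasure_eq_measure)
qed

subsection \<open>A single stratum\<close>

lemma finite_assignments [simp]: "finite (assignments I n cnt)"
  by (rule finite_subset[of _ "{1..n} \<rightarrow>\<^sub>E {1..I}"]) (auto simp: assignments_def intro: finite_PiE)

lemma assignments_range: "z \<in> assignments I n cnt \<Longrightarrow> s \<in> {1..n} \<Longrightarrow> z s \<in> {1..I}"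
  unfolding assignments_def by blast

text \<open>With the cells prescribed, the assignments on \<open>R\<close> and on its complement
  \<open>Q\<close> are chosen independently, and each choice is counted by a multinomial
  coefficient.\<close>

lemma card_assignments_cell_count:
  assumes sum: "(\<Sum>i=1..I. cnt i) = n" and t: "t \<in> {1..I} \<rightarrow>\<^sub>E UNIV" "(\<Sum>i=1..I. t i) = outcome_count n r"
  shows "card {z \<in> assignments I n cnt. restrict (cell_count n r z) {1..I} = t} * (\<Prod>i=1..I. fact (cnt i))
    = fact (outcome_count n r) * fact (n - outcome_count n r) * (\<Prod>i=1..I. cnt i choose t i)"
proof -
  let ?Z = "{z \<in> assignments I n cnt. restrict (cell_count n r z) {1..I} = t}"
  define R where "R = {s \<in> {1..n}. r s = 2}"
  define Q where "Q = {s \<in> {1..n}. r s \<noteq> 2}"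
  have RQ: "finite R" "finite Q" "R \<inter> Q = {}" "R \<union> Q = {1..n}"
    by (auto simp: R_def Q_def)
  have cR: "card R = outcome_count n r"
    by (simp add: R_def outcome_count_def)
  have cQ: "card R + card Q = n"
    using card_Un_disjoint[OF RQ(1-3)] RQ(4) by simp
  have cQ': "n - outcome_count n r = card Q"
    using cQ cR by simp
  have cell: "cell_count n r z i = card {s\<in>R. z s = i}" for z i
    unfolding cell_count_def R_def by (rule arg_cong[where f = card]) auto
  have split: "card {s\<in>{1..n}. z s = i} = card {s\<in>R. z s = i} + card {s\<in>Q. z s = i}" for z :: "nat \<Rightarrow> nat" and i
  proof -
    have "{s\<in>{1..n}. z s = i} = {s\<in>R. z s = i} \<union> {s\<in>Q. z s = i}"
      using RQ by auto
    then show ?thesis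
      using RQ by (simp add: card_Un_disjoint disjoint_iff)
  qed
  \<comment> \<open>Writing the condition on \<open>Q\<close> as a sum keeps it correct when
    \<open>t i\<close> exceeds \<open>cnt i\<close>.\<close>
  have Z: "?Z = {z \<in> {1..n} \<rightarrow>\<^sub>E {1..I}. \<forall>i\<in>{1..I}. card {s\<in>R. z s = i} = t i \<and> card {s\<in>Q. z s = i} + t i = cnt i}"
  proof -
    have "restrict (cell_count n r z) {1..I} = t \<longleftrightarrow> (\<forall>i\<in>{1..I}. card {s\<in>R. z s = i} = t i)" for z
    proof
      show "\<forall>i\<in>{1..I}. card {s\<in>R. z s = i} = t i" if "restrict (cell_count n r z) {1..I} = t"
        unfolding that[symmetric] by (simp add: cell)
      show "restrict (cell_count n r z) {1..I} = t" if "\<forall>i\<in>{1..I}. card {s\<in>R. z s = i} = t i"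
        using t(1) that by (auto simp: cell PiE_def extensional_def)
    qed
    then show ?thesis
      unfolding assignments_def by (auto simp: split add.commute simp del: atLeastAtMost_iff One_nat_def)
  qed
  show ?thesis
  proof (cases "\<forall>i\<in>{1..I}. t i \<le> cnt i")
    \<comment> \<open>Here no assignment exists and a binomial coefficient vanishes, so both sides
      are 0.\<close>
    case False
    then obtain i where i: "i \<in> {1..I}" "cnt i < t i"
      by force
    then have empty: "?Z = {}"
      unfolding Z by fastforce
    have "(\<Prod>i=1..I. cnt i choose t i) = 0"
      using i by (intro prod_zero) auto
    then show ?thesis
      unfolding empty by simp
  next
    case True
    let ?A = "{z \<in> R \<rightarrow>\<^sub>E {1..I}. \<forall>i\<in>{1..I}. card {s\<in>R. z s = i} = t i}"
    let ?B = "{z \<in> Q \<rightarrow>\<^sub>E {1..I}. \<forall>i\<in>{1..I}. card {s\<in>Q. z s = i} = cnt i - t i}"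
    have "bij_betw (\<lambda>z. (restrict z R, restrict z Q)) ?Z
      {y \<in> (R \<rightarrow>\<^sub>E {1..I}) \<times> (Q \<rightarrow>\<^sub>E {1..I}). (\<forall>i\<in>{1..I}. card {s\<in>R. fst y s = i} = t i) \<and>
        (\<forall>i\<in>{1..I}. card {s\<in>Q. snd y s = i} = cnt i - t i)}"
      unfolding Z
    proof (rule bij_betw_Collect)
      show "bij_betw (\<lambda>z. (restrict z R, restrict z Q)) ({1..n} \<rightarrow>\<^sub>E {1..I})
          ((R \<rightarrow>\<^sub>E {1..I}) \<times> (Q \<rightarrow>\<^sub>E {1..I}))"
        using bij_betw_restrict_Un[OF RQ(3)] unfolding RQ(4) .
      have r: "{s\<in>X. restrict z X s = i} = {s\<in>X. z s = i}" for X :: "nat set" and z :: "nat \<Rightarrow> nat" and i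
        by auto
      have cnt: "c = cnt i - t i \<longleftrightarrow> c + t i = cnt i" if "i \<in> {1..I}" for c i
        using True that by auto
      show "(\<forall>i\<in>{1..I}. card {s\<in>R. fst (restrict z R, restrict z Q) s = i} = t i) \<and>
          (\<forall>i\<in>{1..I}. card {s\<in>Q. snd (restrict z R, restrict z Q) s = i} = cnt i - t i) \<longleftrightarrow>
          (\<forall>i\<in>{1..I}. card {s\<in>R. z s = i} = t i \<and> card {s\<in>Q. z s = i} + t i = cnt i)" for z
        unfolding fst_conv snd_conv r ball_conj_distrib by (simp only: cnt cong: ball_cong)
    qed
    moreover have "{y \<in> (R \<rightarrow>\<^sub>E {1..I}) \<times> (Q \<rightarrow>\<^sub>E {1..I}). (\<forall>i\<in>{1..I}. card {s\<in>R. fst y s = i} = t i) \<and>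
        (\<forall>i\<in>{1..I}. card {s\<in>Q. snd y s = i} = cnt i - t i)} = ?A \<times> ?B"
      by (rule set_eqI) (auto simp: mem_Times_iff)
    ultimately have "bij_betw (\<lambda>z. (restrict z R, restrict z Q)) ?Z (?A \<times> ?B)"
      by (simp only:)
    then have card_Z: "card ?Z = card ?A * card ?B"
      by (simp add: bij_betw_same_card card_cartesian_product)
    have A: "card ?A * (\<Prod>i=1..I. fact (t i)) = fact (outcome_count n r)"
      using card_fibres[of R "{1..I}" t] RQ t cR by simp
    have "(\<Sum>i=1..I. cnt i - t i) = card Q"
      using True sum t cR cQ by (subst sum_subtractf_nat) auto
    then have B: "card ?B * (\<Prod>i=1..I. fact (cnt i - t i)) = fact (n - outcome_count n r)"
      using card_fibres[of Q "{1..I}" "\<lambda>i. cnt i - t i"] RQ(2) by (simp add: cR cQ')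
    have "(\<Prod>i=1..I. fact (cnt i)) = (\<Prod>i=1..I. fact (t i) * fact (cnt i - t i) * (cnt i choose t i))"
      using True by (intro prod.cong) (auto simp: binomial_fact_lemma)
    also have "\<dots> = (\<Prod>i=1..I. fact (t i)) * (\<Prod>i=1..I. fact (cnt i - t i)) * (\<Prod>i=1..I. cnt i choose t i)"
      by (simp add: prod.distrib)
    finally show ?thesis
      unfolding card_Z A[symmetric] B[symmetric] by (simp only: mult_ac)
  qed
qed

lemma assignments_nonempty:
  assumes "(\<Sum>i=1..I. cnt i) = n"
  shows "assignments I n cnt \<noteq> {}"
proof
  assume "assignments I n cnt = {}"
  moreover have "card (assignments I n cnt) * (\<Prod>i=1..I. fact (cnt i)) = (fact n :: nat)"
    using card_fibres[of "{1..n}" "{1..I}" cnt] assms unfolding assignments_def by simp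
  ultimately show False
    by simp
qed

section \<open>Treated sets, weights and scores in one stratum\<close>

locale stratum =
  fixes I n :: nat and cnt r :: "nat \<Rightarrow> nat" and w :: "nat \<Rightarrow> real" and \<gamma> :: real and \<delta> :: "nat \<Rightarrow> real"
  assumes counts_sum: "(\<Sum>i=1..I. cnt i) = n"
    and gamma_nonneg: "\<gamma> \<ge> 0"
    and delta_binary: "i \<in> {1..I} \<Longrightarrow> \<delta> i \<in> {0, 1}"
    and aligned: "i \<in> {1..I} \<Longrightarrow> j \<in> {1..I} \<Longrightarrow> \<delta> i < \<delta> j \<Longrightarrow> w i \<le> w j"
begin

definition R :: "nat set" where "R = {s \<in> {1..n}. r s = 2}"

definition treated :: "(nat \<Rightarrow> nat) \<Rightarrow> nat set" where "treated z = {s \<in> {1..n}. \<delta> (z s) = 1}"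

text \<open>The common size of the sets \<open>treated z\<close>; see
  \<open>card_treated\<close>.\<close>

definition m :: nat where "m = (\<Sum>i | i \<in> {1..I} \<and> \<delta> i = 1. cnt i)"

definition weight :: "(nat \<Rightarrow> real) \<Rightarrow> (nat \<Rightarrow> nat) \<Rightarrow> real" where
  "weight u z = exp (\<gamma> * (\<Sum>s=1..n. \<delta> (z s) * u s))"

definition score :: "(nat \<Rightarrow> nat) \<Rightarrow> real" where "score z = sign_score I w (cell_count n r z)"

text \<open>The indicator of \<open>R\<close> on the subjects. It is the maximising confounder and
  also the coefficient with which a subject enters the score.\<close>

definition worst :: "nat \<Rightarrow> real" where "worst s = of_bool (r s = 2)"

abbreviation Z :: "(nat \<Rightarrow> nat) set" where "Z \<equiv> assignments I n cnt"

text \<open>Subjects are grouped by treatment. The coefficients \<open>v\<close> are arbitrary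
  because \<open>w\<close>, \<open>\<delta>\<close> and the constant 1 all occur later.\<close>

lemma sign_score_cell_count:
  assumes "z \<in> Z"
  shows "sign_score I v (cell_count n r z) = (\<Sum>s=1..n. v (z s) * worst s)"
proof -
  have "sign_score I v (cell_count n r z) = (\<Sum>i=1..I. \<Sum>s\<in>{s\<in>R. z s = i}. v (z s))"
    unfolding sign_score_def cell_count_def R_def
    by (intro sum.cong) (auto simp: conj_ac intro!: arg_cong[where f = card])
  also have "\<dots> = (\<Sum>s\<in>R. v (z s))"
    using assignments_range[OF assms] by (intro sum.group) (auto simp: R_def)
  also have "\<dots> = (\<Sum>s=1..n. v (z s) * worst s)"
    by (intro sum.mono_neutral_cong_left) (auto simp: R_def worst_def)
  finally show ?thesis .
qed

lemma card_treated:
  assumes "z \<in> Z"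
  shows "card (treated z) = m"
proof -
  have "card (treated z) = (\<Sum>i\<in>{i \<in> {1..I}. \<delta> i = 1}. \<Sum>s\<in>{s\<in>treated z. z s = i}. 1)"
    using assignments_range[OF assms] by (subst sum.group) (auto simp: treated_def)
  also have "\<dots> = m"
    unfolding m_def
  proof (intro sum.cong refl)
    fix i assume i: "i \<in> {i. i \<in> {1..I} \<and> \<delta> i = 1}"
    then have "{s\<in>treated z. z s = i} = {s\<in>{1..n}. z s = i}"
      by (auto simp: treated_def)
    then show "(\<Sum>s\<in>{s\<in>treated z. z s = i}. 1) = cnt i"
      using assms i by (simp add: assignments_def)
  qed
  finally show ?thesis .
qed

text \<open>As \<open>\<delta>\<close> takes only the values 0 and 1 on treatments, the exponent is
  a sum over the treated subjects.\<close>

lemma weight_eq: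
  assumes "z \<in> Z"
  shows "weight u z = (\<Prod>s\<in>treated z. exp (\<gamma> * u s))"
proof -
  have "(\<Sum>s=1..n. \<delta> (z s) * u s) = (\<Sum>s\<in>treated z. u s)"
  proof (rule sum.mono_neutral_cong_right)
    show "\<forall>s\<in>{1..n} - treated z. \<delta> (z s) * u s = 0"
      using delta_binary[OF assignments_range[OF assms]] by (fastforce simp: treated_def)
  qed (auto simp: treated_def)
  then show ?thesis
    by (simp add: weight_def sum_distrib_left exp_sum treated_def)
qed

lemma transpose_assignment:
  assumes "z \<in> Z" "p \<in> {1..n}" "q \<in> {1..n}"
  shows "z \<circ> Transposition.transpose p q \<in> Z"
proof -
  have mem: "Transposition.transpose p q s \<in> {1..n} \<longleftrightarrow> s \<in> {1..n}" for s
    using assms(2,3) by (auto simp: Transposition.transpose_def)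
  have "bij_betw (Transposition.transpose p q) {s\<in>{1..n}. z (Transposition.transpose p q s) = i} {s\<in>{1..n}. z s = i}" for i
    by (rule bij_betw_byWitness[where f' = "Transposition.transpose p q"]) (auto simp: mem simp del: atLeastAtMost_iff One_nat_def)
  then have "card {s\<in>{1..n}. z (Transposition.transpose p q s) = i} = card {s\<in>{1..n}. z s = i}" for i
    by (rule bij_betw_same_card)
  moreover have "z \<circ> Transposition.transpose p q \<in> {1..n} \<rightarrow>\<^sub>E {1..I}"
    using assms mem by (auto simp: assignments_def PiE_iff extensional_def simp del: atLeastAtMost_iff One_nat_def)
  ultimately show ?thesis
    using assms by (auto simp: assignments_def)
qed

text \<open>The weight depends on \<open>z\<close> only through \<open>treated z\<close>, so these
  counts and the weights of subsets determine the law of the score.\<close>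

definition ways :: "real set \<Rightarrow> nat set \<Rightarrow> real" where
  "ways U A = real (card {z \<in> Z. treated z = A \<and> score z \<in> U})"

text \<open>
  Exchanging the treatments of a treated subject \<open>q\<close> and an untreated subject \<open>p\<close> changes the score
  by \<open>(w (z q) - w (z p)) * (worst p - worst q)\<close>, and alignment makes the first factor nonnegative.
\<close>

lemma ways_exchange:
  assumes "upset U" and A: "q \<in> A" "p \<in> {1..n} - A" "A \<subseteq> {1..n}"
    and R: "U = UNIV \<or> (q \<in> R \<longrightarrow> p \<in> R)"
  shows "ways U A \<le> ways U (insert p (A - {q}))"
proof -
  have pq: "p \<in> {1..n}" "q \<in> {1..n}" "p \<noteq> q"
    using A by auto
  have "card {z \<in> Z. treated z = A \<and> score z \<in> U}
      \<le> card {z \<in> Z. treated z = insert p (A - {q}) \<and> score z \<in> U}"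
  proof (rule card_inj_on_le[where f = "\<lambda>z. z \<circ> Transposition.transpose p q"])
    show "inj_on (\<lambda>z. z \<circ> Transposition.transpose p q) {z \<in> Z. treated z = A \<and> score z \<in> U}"
      by (rule inj_onI) (metis comp_assoc transpose_comp_involutory comp_id)
    show "(\<lambda>z. z \<circ> Transposition.transpose p q) ` {z \<in> Z. treated z = A \<and> score z \<in> U}
        \<subseteq> {z \<in> Z. treated z = insert p (A - {q}) \<and> score z \<in> U}"
    proof clarify
      fix z assume z: "z \<in> Z" "A = treated z" "score z \<in> U"
      let ?z = "z \<circ> Transposition.transpose p q"
      have z': "?z \<in> Z"
        using z pq by (intro transpose_assignment)
      have "treated ?z = insert p (treated z - {q})"
        using A z(2) pq by (auto simp: treated_def Transposition.transpose_def split: if_splits)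
      moreover have "score ?z \<in> U"
      \<comment> \<open>For \<open>U = UNIV\<close> the score is unrestricted, so every exchange is
        allowed, whatever the outcomes.\<close>
      proof (cases "U = UNIV")
        case False
        with R have imp: "q \<in> R \<longrightarrow> p \<in> R"
          by simp
        have "\<delta> (z q) = 1" "\<delta> (z p) = 0"
          using A z(2) delta_binary[OF assignments_range[OF z(1) pq(1)]] by (auto simp: treated_def)
        then have "w (z p) \<le> w (z q)"
          using assignments_range[OF z(1)] pq by (intro aligned) auto
        moreover have "worst q \<le> worst p"
          using imp pq by (auto simp: worst_def R_def)
        ultimately have "0 \<le> (w (z q) - w (z p)) * (worst p - worst q)"
          by simp
        also have "\<dots> = score ?z - score z"
        proof -
          have *: "(\<Sum>s=1..n. f s) = f p + f q + (\<Sum>s\<in>{1..n} - {p, q}. f s)" for f :: "nat \<Rightarrow> real"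
          proof -
            have "(\<Sum>s=1..n. f s) = (\<Sum>s\<in>{1..n} - {p, q}. f s) + (\<Sum>s\<in>{p, q}. f s)"
              using pq by (intro sum.subset_diff) auto
            then show ?thesis
              using pq by simp
          qed
          have "(\<Sum>s\<in>{1..n} - {p, q}. w (?z s) * worst s) = (\<Sum>s\<in>{1..n} - {p, q}. w (z s) * worst s)"
            by (intro sum.cong) (auto simp: Transposition.transpose_def)
          then show ?thesis
            unfolding score_def sign_score_cell_count[OF z(1)] sign_score_cell_count[OF z'] *
            by (simp add: algebra_simps)
        qed
        finally have "score z \<le> score ?z"
          by simp
        then show ?thesis
          using z(3) \<open>upset U\<close> by (auto simp: upset_def)
      qed simp
      ultimately show "?z \<in> Z \<and> treated ?z = insert p (treated z - {q}) \<and> score ?z \<in> U"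
        using z' by simp
    qed
  qed simp
  then show ?thesis
    by (simp add: ways_def)
qed

text \<open>Chains single exchanges. Used in both directions, it shows that sets of equal size with
  equally many points in \<open>R\<close> have equal counts.\<close>

lemma ways_mono:
  assumes "upset U" "A \<subseteq> {1..n}" "A' \<subseteq> {1..n}" "card A = card A'" "card (A \<inter> R) \<le> card (A' \<inter> R)"
  shows "ways U A \<le> ways U A'"
proof (rule exchange_mono[where S = "{1..n}" and R = R])
  show "ways U A \<le> ways U (insert p (A - {q}))"
    if "A \<subseteq> {1..n}" "q \<in> A" "p \<in> {1..n} - A" "q \<in> R \<Longrightarrow> p \<in> R" for A p q
    using assms(1) that by (intro ways_exchange) blast+
qed (use assms in simp_all)

text \<open>Taking the empty set for the reference set in \<open>exchange_mono\<close> permits every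
  exchange, so any two sets of equal size can be compared both ways.\<close>

lemma ways_UNIV_eq:
  assumes "A \<subseteq> {1..n}" "A' \<subseteq> {1..n}" "card A = card A'"
  shows "ways UNIV A = ways UNIV A'"
proof (rule antisym)
  have up: "upset (UNIV :: real set)"
    by (simp add: upset_def)
  have le: "ways UNIV B \<le> ways UNIV B'" if "B \<subseteq> {1..n}" "B' \<subseteq> {1..n}" "card B = card B'" for B B'
  proof (rule exchange_mono[where S = "{1..n}" and R = "{}"])
    show "ways UNIV A \<le> ways UNIV (insert p (A - {q}))"
      if "A \<subseteq> {1..n}" "q \<in> A" "p \<in> {1..n} - A" for A p q
      using up that by (intro ways_exchange) blast+
  qed (use that in simp_all)
  show "ways UNIV A \<le> ways UNIV A'" "ways UNIV A' \<le> ways UNIV A"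
    using le assms by auto
qed

abbreviation P :: "nat set set" where "P \<equiv> {A. A \<subseteq> {1..n} \<and> card A = m}"

lemma sum_weight:
  "(\<Sum>z | z \<in> Z \<and> score z \<in> U. weight u z) = (\<Sum>A\<in>P. ways U A * (\<Prod>s\<in>A. exp (\<gamma> * u s)))"
proof -
  have "(\<Sum>z | z \<in> Z \<and> score z \<in> U. weight u z)
      = (\<Sum>A\<in>P. \<Sum>z | z \<in> {z. z \<in> Z \<and> score z \<in> U} \<and> treated z = A. weight u z)"
    by (rule sum.group[symmetric]) (auto simp: card_treated, auto simp: treated_def)
  also have "\<dots> = (\<Sum>A\<in>P. \<Sum>z | z \<in> Z \<and> treated z = A \<and> score z \<in> U. \<Prod>s\<in>A. exp (\<gamma> * u s))"
    by (intro sum.cong) (auto simp: weight_eq)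
  finally show ?thesis
    by (simp add: ways_def)
qed

lemma treatment_pmf_eq: "treatment_pmf I n cnt \<gamma> \<delta> u = weighted_pmf Z (weight u)"
  unfolding treatment_pmf_def weight_def ..

lemma sum_weight_pos: "0 < sum (weight u) Z"
  using assignments_nonempty[OF counts_sum] by (intro sum_pos) (auto simp: weight_def)

lemma prob_score:
  "measure_pmf.prob (map_pmf score (treatment_pmf I n cnt \<gamma> \<delta> u)) U
    = (\<Sum>z | z \<in> Z \<and> score z \<in> U. weight u z) / sum (weight u) Z"
  unfolding treatment_pmf_eq using sum_weight_pos
  by (simp add: measure_weighted_pmf weight_def)

text \<open>The event counts are an increasing function of \<open>card (A \<inter> R)\<close> and
  the total counts are constant on \<open>P\<close>, so the claim reduces to
  \<open>weighted_subsets_dominance\<close>.\<close>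

lemma score_dominance:
  assumes "upset U" and u: "\<And>s. s \<in> {1..n} \<Longrightarrow> u s \<in> {0..1}"
  shows "measure_pmf.prob (map_pmf score (treatment_pmf I n cnt \<gamma> \<delta> u)) U
    \<le> measure_pmf.prob (map_pmf score (treatment_pmf I n cnt \<gamma> \<delta> worst)) U"
proof -
  let ?v = "\<lambda>u s. exp (\<gamma> * u s)"
  \<comment> \<open>The running maximum is monotone on all of \<open>nat\<close>, including sizes
    that no \<open>A\<close> attains, where the inserted 0 avoids an empty maximum. At attained
    sizes it equals the count by \<open>ways_mono\<close>.\<close>
  define F where "F j = Max (insert 0 (ways U ` {A\<in>P. card (A \<inter> R) \<le> j}))" for j
  have fin: "finite (insert 0 (ways U ` {A\<in>P. card (A \<inter> R) \<le> j}))" for j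
    by simp
  have "mono F"
    unfolding F_def by (intro monoI Max_mono) (auto intro: order.trans)
  have F: "F (card (A \<inter> R)) = ways U A" if "A \<in> P" for A
    unfolding F_def
    by (rule Max_eqI[OF fin]) (use that ways_mono[OF \<open>upset U\<close>] in \<open>auto simp: ways_def\<close>)
  obtain d where d: "ways UNIV A = d" if "A \<in> P" for A
    using ways_UNIV_eq by (metis (mono_tags, lifting) mem_Collect_eq)
  have num: "(\<Sum>z | z \<in> Z \<and> score z \<in> U. weight u z) = (\<Sum>A\<in>P. F (card (A \<inter> R)) * (\<Prod>s\<in>A. ?v u s))" for u
    unfolding sum_weight using F by (intro sum.cong) auto
  have den: "sum (weight u) Z = d * (\<Sum>A\<in>P. \<Prod>s\<in>A. ?v u s)" for u
    using sum_weight[where U = UNIV and u = u] d by (simp add: sum_distrib_left)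
  have "0 \<le> d"
  proof (rule ccontr)
    assume "\<not> 0 \<le> d"
    then have "sum (weight u) Z \<le> 0"
      unfolding den by (intro mult_nonpos_nonneg sum_nonneg prod_nonneg) auto
    then show False
      using sum_weight_pos[of u] by simp
  qed
  have worst: "(\<Prod>s\<in>A. ?v worst s) = (\<Prod>s\<in>A. if s \<in> R then exp \<gamma> else 1)" if "A \<in> P" for A
    using that by (intro prod.cong) (auto simp: R_def worst_def)
  have "(\<Sum>A\<in>P. F (card (A \<inter> R)) * (\<Prod>s\<in>A. ?v worst s))
      = (\<Sum>A\<in>P. F (card (A \<inter> R)) * (\<Prod>s\<in>A. if s \<in> R then exp \<gamma> else 1))"
    and "(\<Sum>A\<in>P. \<Prod>s\<in>A. ?v worst s) = (\<Sum>A\<in>P. \<Prod>s\<in>A. if s \<in> R then exp \<gamma> else 1)"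
    by (simp_all only: worst cong: sum.cong)
  \<comment> \<open>The bounds on the weights are \<open>l = 1\<close> and
    \<open>h = exp \<gamma>\<close>, since \<open>\<gamma> * u s\<close> lies between 0 and
    \<open>\<gamma>\<close>.\<close>
  moreover have "(\<Sum>A\<in>P. F (card (A \<inter> R)) * (\<Prod>s\<in>A. ?v u s)) * (\<Sum>A\<in>P. \<Prod>s\<in>A. if s \<in> R then exp \<gamma> else 1)
    \<le> (\<Sum>A\<in>P. F (card (A \<inter> R)) * (\<Prod>s\<in>A. if s \<in> R then exp \<gamma> else 1)) * (\<Sum>A\<in>P. \<Prod>s\<in>A. ?v u s)"
    by (rule weighted_subsets_dominance)
      (use \<open>mono F\<close> u gamma_nonneg in \<open>auto simp: R_def mult_left_le\<close>)
  ultimately have le: "(\<Sum>A\<in>P. F (card (A \<inter> R)) * (\<Prod>s\<in>A. ?v u s)) * (\<Sum>A\<in>P. \<Prod>s\<in>A. ?v worst s)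
    \<le> (\<Sum>A\<in>P. F (card (A \<inter> R)) * (\<Prod>s\<in>A. ?v worst s)) * (\<Sum>A\<in>P. \<Prod>s\<in>A. ?v u s)"
    by (simp only:)
  have "(\<Sum>z | z \<in> Z \<and> score z \<in> U. weight u z) * sum (weight worst) Z
      \<le> (\<Sum>z | z \<in> Z \<and> score z \<in> U. weight worst z) * sum (weight u) Z"
    unfolding num den using mult_left_mono[OF le \<open>0 \<le> d\<close>] by (simp only: mult_ac)
  then show ?thesis
    unfolding prob_score using sum_weight_pos[of u] sum_weight_pos[of worst]
    by (simp add: divide_le_eq le_divide_eq mult_ac)
qed

text \<open>At \<open>worst\<close> the weight depends only on the cell counts, and the number of
  assignments with given cells is proportional to the product of binomials. Restriction to
  \<open>{1..I}\<close> puts the counts in the extensional support.\<close>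

lemma cell_count_worst:
  "map_pmf (\<lambda>z. restrict (cell_count n r z) {1..I}) (treatment_pmf I n cnt \<gamma> \<delta> worst)
    = ext_hypergeometric_pmf I cnt (outcome_count n r) (\<lambda>i. \<gamma> * \<delta> i)"
  unfolding treatment_pmf_eq ext_hypergeometric_pmf_def
proof (rule map_weighted_pmf)
  let ?k = "outcome_count n r"
  let ?T = "{t \<in> {1..I} \<rightarrow>\<^sub>E UNIV. (\<Sum>i=1..I. t i) = ?k}"
  \<comment> \<open>The factor in \<open>card_assignments_cell_count\<close> that is independent of
    \<open>t\<close>.\<close>
  let ?c = "real (fact ?k * fact (n - ?k)) / real (\<Prod>i=1..I. fact (cnt i))"
  show "finite ?T"
  proof (rule finite_subset)
    show "?T \<subseteq> {1..I} \<rightarrow>\<^sub>E {..?k}"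
    proof clarify
      fix t assume t: "t \<in> {1..I} \<rightarrow>\<^sub>E (UNIV :: nat set)" "(\<Sum>i=1..I. t i) = ?k"
      have "t i \<le> ?k" if "i \<in> {1..I}" for i
        using that unfolding t(2)[symmetric] by (intro member_le_sum) auto
      then show "t \<in> {1..I} \<rightarrow>\<^sub>E {..?k}"
        using t(1) by (auto simp: PiE_iff)
    qed
  qed (simp add: finite_PiE)
  show "(\<lambda>z. restrict (cell_count n r z) {1..I}) ` Z \<subseteq> ?T"
  proof clarify
    fix z assume z: "z \<in> Z"
    have "real (\<Sum>i=1..I. cell_count n r z i) = (\<Sum>s=1..n. worst s)"
      using sign_score_cell_count[OF z, of "\<lambda>_. 1"] by (simp add: sign_score_def)
    also have "\<dots> = real ?k"
      by (simp add: worst_def outcome_count_def Int_def)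
    finally have "(\<Sum>i=1..I. cell_count n r z i) = ?k"
      by (simp only: of_nat_eq_iff)
    then show "restrict (cell_count n r z) {1..I} \<in> {1..I} \<rightarrow>\<^sub>E UNIV
        \<and> (\<Sum>i=1..I. restrict (cell_count n r z) {1..I} i) = ?k"
      by simp
  qed
  show "0 < ?c"
    by (auto intro!: divide_pos_pos prod_pos)
  show "(\<Sum>z\<in>{z\<in>Z. restrict (cell_count n r z) {1..I} = t}. weight worst z)
      = ?c * (\<Prod>i=1..I. real (cnt i choose t i) * exp (\<gamma> * \<delta> i * real (t i)))" if "t \<in> ?T" for t
  proof -
    let ?Z = "{z\<in>Z. restrict (cell_count n r z) {1..I} = t}"
    have "weight worst z = (\<Prod>i=1..I. exp (\<gamma> * \<delta> i * real (t i)))" if "z \<in> ?Z" for z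
    proof -
      have "z \<in> Z" and t: "t i = cell_count n r z i" if "i \<in> {1..I}" for i
        using that \<open>z \<in> ?Z\<close> by auto
      then have "(\<Sum>s=1..n. \<delta> (z s) * worst s) = (\<Sum>i=1..I. \<delta> i * real (t i))"
        using sign_score_cell_count[of z \<delta>] \<open>z \<in> ?Z\<close> by (simp add: sign_score_def)
      then show ?thesis
        by (simp add: weight_def sum_distrib_left exp_sum mult.assoc)
    qed
    then have "(\<Sum>z\<in>?Z. weight worst z) = real (card ?Z) * (\<Prod>i=1..I. exp (\<gamma> * \<delta> i * real (t i)))"
      by simp
    moreover have "real (card ?Z) = ?c * (\<Prod>i=1..I. real (cnt i choose t i))"
    proof -
      have "real (card ?Z * (\<Prod>i=1..I. fact (cnt i)))
          = real (fact ?k * fact (n - ?k) * (\<Prod>i=1..I. cnt i choose t i))"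
        by (subst card_assignments_cell_count[OF counts_sum]) (use that in auto)
      moreover have "real (\<Prod>i=1..I. fact (cnt i)) \<noteq> 0"
        by simp
      ultimately show ?thesis
        by (simp add: field_simps)
    qed
    ultimately show ?thesis
      by (simp add: prod.distrib)
  qed
qed (use sum_weight_pos in \<open>auto simp: weight_def\<close>)

text \<open>\<open>sign_score\<close> reads only the indices in \<open>{1..I}\<close>, so
  restricting the cell counts leaves it unchanged.\<close>

lemma score_worst:
  "map_pmf score (treatment_pmf I n cnt \<gamma> \<delta> worst)
    = map_pmf (sign_score I w) (ext_hypergeometric_pmf I cnt (outcome_count n r) (\<lambda>i. \<gamma> * \<delta> i))"
  unfolding cell_count_worst[symmetric] by (simp add: pmf.map_comp o_def score_def[abs_def] sign_score_def)

end

section \<open>From single strata to increasing functions of the whole score vector\<close>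

theorem corollary3:
  fixes I :: nat
    and N :: "'k::finite \<Rightarrow> nat"
    and Ntreat :: "'k \<Rightarrow> nat \<Rightarrow> nat"
    and r :: "'k \<Rightarrow> nat \<Rightarrow> nat"
    and w :: "'k \<Rightarrow> nat \<Rightarrow> real"
    and \<gamma> :: real
    and \<delta> :: "nat \<Rightarrow> real"
    and g :: "real^'k \<Rightarrow> real"
  assumes counts_pos: "\<And>k i. i \<in> {1..I} \<Longrightarrow> Ntreat k i > 0"
    and counts_sum: "\<And>k. (\<Sum>i=1..I. Ntreat k i) = N k"
    and outcomes: "\<And>k s. s \<in> {1..N k} \<Longrightarrow> r k s \<in> {1, 2}"
    and gamma_nonneg: "\<gamma> \<ge> 0"
    and delta_binary: "\<And>i. i \<in> {1..I} \<Longrightarrow> \<delta> i \<in> {0, 1}"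
    and delta_nonconst: "\<exists>i\<in>{1..I}. \<exists>j\<in>{1..I}. \<delta> i \<noteq> \<delta> j"
    and w_sorted: "\<And>k. mono_on {1..I} (w k)"
    and delta_w_aligned:
      "\<And>k i j. i \<in> {1..I} \<Longrightarrow> j \<in> {1..I} \<Longrightarrow> \<delta> i < \<delta> j \<Longrightarrow> w k i \<le> w k j"
    and g_mono: "\<And>T T'. (\<And>k. T $ k \<le> T' $ k) \<Longrightarrow> g T \<le> g T'"
  shows "\<forall>c. is_max_over
               (\<lambda>u. measure_pmf.prob (score_pmf I N Ntreat r w \<gamma> \<delta> u) {T. g T \<ge> c})
               (confounders N)
               (measure_pmf.prob (score_bar_pmf I N Ntreat r w \<gamma> \<delta>) {T. g T \<ge> c})"
proof
  fix c
  interpret stratum I "N k" "Ntreat k" "r k" "w k" \<gamma> \<delta> for k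
    using counts_sum gamma_nonneg delta_binary delta_w_aligned by unfold_locales auto
  let ?p = "\<lambda>u k. map_pmf (\<lambda>Z. sign_score I (w k) (cell_count (N k) (r k) Z))
    (treatment_pmf I (N k) (Ntreat k) \<gamma> \<delta> (u k))"
  let ?q = "\<lambda>k. map_pmf (sign_score I (w k))
    (ext_hypergeometric_pmf I (Ntreat k) (outcome_count (N k) (r k)) (\<lambda>i. \<gamma> * \<delta> i))"
  \<comment> \<open>One confounder is extremal in every stratum and for every \<open>c\<close>, so
    it attains the maximum.\<close>
  let ?worst = "\<lambda>k s. of_bool (r k s = 2) :: real"
  \<comment> \<open>Both laws are rewritten as images of products of the laws of single scores, so
    that dominance can be used stratum by stratum. The product is over \<open>UNIV\<close>, so the
    default 0 is an arbitrary choice.\<close>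
  have p: "score_pmf I N Ntreat r w \<gamma> \<delta> u = map_pmf vec_lambda (Pi_pmf UNIV 0 (?p u))" for u
    unfolding score_pmf_def
    by (subst Pi_pmf_map_dep[where d' = undefined]) (simp_all add: pmf.map_comp o_def)
  have q: "score_bar_pmf I N Ntreat r w \<gamma> \<delta> = map_pmf vec_lambda (Pi_pmf UNIV 0 ?q)"
    unfolding score_bar_pmf_def
    by (subst Pi_pmf_map_dep[where d' = undefined]) (simp_all add: pmf.map_comp o_def)
  have worst: "?p ?worst = ?q"
  proof
    show "?p ?worst k = ?q k" for k
      using score_worst[where k = k] unfolding score_def[abs_def] worst_def[abs_def] .
  qed
  \<comment> \<open>Monotonicity of \<open>g\<close> makes the event increasing in the pointwise
    order on functions, as \<open>Pi_pmf_upset_le\<close> requires.\<close>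
  have up: "upset (vec_lambda -` {T. c \<le> g T})"
    unfolding upset_def
  proof clarsimp
    fix x y :: "'k \<Rightarrow> real"
    assume "c \<le> g (vec_lambda x)" "x \<le> y"
    moreover from \<open>x \<le> y\<close> have "g (vec_lambda x) \<le> g (vec_lambda y)"
      by (intro g_mono) (simp add: le_fun_def)
    ultimately show "c \<le> g (vec_lambda y)"
      by linarith
  qed
  have "?worst \<in> confounders N"
    by (simp add: confounders_def)
  moreover have "score_pmf I N Ntreat r w \<gamma> \<delta> ?worst = score_bar_pmf I N Ntreat r w \<gamma> \<delta>"
    unfolding p q worst ..
  moreover have "measure_pmf.prob (score_pmf I N Ntreat r w \<gamma> \<delta> u) {T. c \<le> g T}
      \<le> measure_pmf.prob (score_bar_pmf I N Ntreat r w \<gamma> \<delta>) {T. c \<le> g T}"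
    if u: "u \<in> confounders N" for u
    unfolding p q worst[symmetric] measure_map_pmf
  proof (rule Pi_pmf_upset_le[OF _ _ up])
    show "measure_pmf.prob (?p u k) U \<le> measure_pmf.prob (?p ?worst k) U" if "upset U" for k U
      using score_dominance[where k = k, OF that, of "u k"] u
      unfolding score_def[abs_def] worst_def[abs_def] confounders_def by blast
  qed simp
  ultimately show "is_max_over
      (\<lambda>u. measure_pmf.prob (score_pmf I N Ntreat r w \<gamma> \<delta> u) {T. c \<le> g T}) (confounders N)
      (measure_pmf.prob (score_bar_pmf I N Ntreat r w \<gamma> \<delta>) {T. c \<le> g T})"
    unfolding is_max_over_def by (intro conjI ballI bexI[where x = ?worst]) simp_all
qed

end
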